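(* Let $\mathbb{K}$ be a finite field and $x\in\mathbb{K}$ with $x\neq 0_{\mathbb{K}}$. Then the $(x,\mathbb{K})$-monomial minimal solution of $(E_{\mathbb{K}})$ is irreducible.
   Context: Let $A$ be a commutative unital ring ($0_A\neq 1_A$). For $a_1,\ldots,a_n\in A$ set $M_n(a_1,\ldots,a_n)=\begin{pmatrix} a_n & -1_A\\ 1_A & 0_A\end{pmatrix}\cdots\begin{pmatrix} a_1 & -1_A\\ 1_A & 0_A\end{pmatrix}$. An $n$-tuple is a solution of $(E_A)$ if $M_n(a_1,\ldots,a_n)=\pm \mathrm{Id}$. For tuples, $(a_1,\ldots,a_n)\oplus(b_1,\ldots,b_m)=(a_1+b_m,a_2,\ldots,a_{n-1},a_n+b_1,b_2,\ldots,b_{m-1})$. Write $(a_1,\ldots,a_n)\sim(b_1,\ldots,b_n)$ if $(b_1,\ldots,b_n)$ is obtained from $(a_1,\ldots,a_n)$ or from $(a_n,\ldots,a_1)$ by a cyclic permutation. A solution $(c_1,\ldots,c_n)$ with $n\geq 3$ is reducible if there exist a solution $(b_1,\ldots,b_l)$ and a tuple $(a_1,\ldots,a_m)$ of elements of $A$ with $l,m\geq 3$ and $(c_1,\ldots,c_n)\sim(a_1,\ldots,a_m)\oplus(b_1,\ldots,b_l)$; otherwise it is irreducible. For $A$ finite and $x\in A$, the $(x,A)$-monomial minimal solution of $(E_A)$ is the solution all of whose components equal $x$, of minimal size; it exists. *)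

theory Defs
  imports "HOL-Analysis.Analysis"
begin

text \<open>A tuple \<open>(a\<^sub>1, \<dots>, a\<^sub>n)\<close> over a commutative ring is the list \<open>[a\<^sub>1, \<dots>, a\<^sub>n]\<close>.\<close>

definition elem_matrix :: "'a::comm_ring_1 \<Rightarrow> 'a^2^2" where
  "elem_matrix a = vector [vector [a, -1], vector [1, 0]]"

text \<open>The first entry of the tuple contributes the rightmost factor of the product.\<close>

primrec M_matrix :: "'a::comm_ring_1 list \<Rightarrow> 'a^2^2" where
  "M_matrix [] = mat 1"
| "M_matrix (a # as) = M_matrix as ** elem_matrix a"

text \<open>Tuples have positive size; without this the empty list would be a solution.\<close>

definition is_solution :: "'a::comm_ring_1 list \<Rightarrow> bool" where
  "is_solution cs \<longleftrightarrow> cs \<noteq> [] \<and> (M_matrix cs = mat 1 \<or> M_matrix cs = - mat 1)"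

text \<open>The sum \<open>(a\<^sub>1 + b\<^sub>m, a\<^sub>2, \<dots>, a\<^sub>n\<^sub>-\<^sub>1, a\<^sub>n + b\<^sub>1, b\<^sub>2, \<dots>, b\<^sub>m\<^sub>-\<^sub>1)\<close>,
  meaningful for tuples of size at least two.\<close>

definition tuple_sum :: "'a::comm_ring_1 list \<Rightarrow> 'a list \<Rightarrow> 'a list" (infixl "\<oplus>\<^sub>t" 65) where
  "as \<oplus>\<^sub>t bs = [hd as + last bs] @ butlast (tl as) @ [last as + hd bs] @ butlast (tl bs)"

definition tuple_equiv :: "'a list \<Rightarrow> 'a list \<Rightarrow> bool" (infix "\<sim>\<^sub>t" 50) where
  "as \<sim>\<^sub>t bs \<longleftrightarrow> (\<exists>k. bs = rotate k as \<or> bs = rotate k (rev as))"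

definition reducible_solution :: "'a::comm_ring_1 list \<Rightarrow> bool" where
  "reducible_solution cs \<longleftrightarrow> is_solution cs \<and> length cs \<ge> 3 \<and>
     (\<exists>as bs. is_solution bs \<and> length as \<ge> 3 \<and> length bs \<ge> 3 \<and> cs \<sim>\<^sub>t as \<oplus>\<^sub>t bs)"

text \<open>As for reducibility, only solutions of size at least three are considered.\<close>

definition irreducible_solution :: "'a::comm_ring_1 list \<Rightarrow> bool" where
  "irreducible_solution cs \<longleftrightarrow> is_solution cs \<and> length cs \<ge> 3 \<and> \<not> reducible_solution cs"

definition monomial_minimal_size :: "'a::{comm_ring_1,finite} \<Rightarrow> nat" where
  "monomial_minimal_size x = (LEAST n. is_solution (replicate n x))"

definition monomial_minimal_solution :: "'a::{comm_ring_1,finite} \<Rightarrow> 'a list" where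
  "monomial_minimal_solution x = replicate (monomial_minimal_size x) x"

text \<open>The minimum above is attained, so the monomial minimal solution is indeed a solution.\<close>

lemma M_matrix_append: "M_matrix (as @ bs) = M_matrix bs ** M_matrix as"
  by (induction as) (simp_all add: matrix_mul_assoc)

lemma elem_matrix_left_inverse:
  "vector [vector [0, 1], vector [-1, a]] ** elem_matrix (a::'a::comm_ring_1) = (mat 1 :: 'a^2^2)"
  by (simp add: elem_matrix_def matrix_matrix_mult_def mat_def vec_eq_iff sum_2 forall_2)

lemma M_matrix_left_inverse:
  fixes as :: "'a::comm_ring_1 list"
  shows "\<exists>L. L ** M_matrix as = (mat 1 :: 'a^2^2)"
proof (induction as rule: rev_induct)
  case Nil
  show ?case by (auto intro: exI[of _ "mat 1"])
next
  case (snoc a as)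
  then obtain L :: "'a^2^2" where L: "L ** M_matrix as = mat 1" by blast
  let ?E = "vector [vector [0, 1], vector [-1, a]] :: 'a^2^2"
  have "(L ** ?E) ** M_matrix (as @ [a]) = L ** ((?E ** elem_matrix a) ** M_matrix as)"
    by (simp add: M_matrix_append matrix_mul_assoc)
  also have "\<dots> = mat 1"
    by (simp add: elem_matrix_left_inverse L)
  finally show ?case by blast
qed

lemma monomial_minimal_solution_is_solution:
  fixes x :: "'a::{comm_ring_1,finite}"
  shows "is_solution (monomial_minimal_solution x)"
proof -
  let ?f = "\<lambda>n. M_matrix (replicate n x)"
  have "\<not> inj ?f"
    using finite_imageD[of ?f UNIV] infinite_UNIV_nat by auto
  then obtain i j where "i \<noteq> j" "?f i = ?f j"
    by (auto simp: inj_on_def)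
  then obtain i j where ij: "i < j" "?f i = ?f j"
    by (metis linorder_neqE_nat)
  obtain L where L: "L ** ?f i = mat 1"
    using M_matrix_left_inverse by blast
  have "replicate j x = replicate (j - i) x @ replicate i x"
    using ij(1) by (simp flip: replicate_add)
  then have "?f j = ?f i ** ?f (j - i)"
    by (simp add: M_matrix_append)
  then have "L ** ?f i = (L ** ?f i) ** ?f (j - i)"
    using ij(2) by (simp flip: matrix_mul_assoc)
  then have "?f (j - i) = mat 1"
    by (simp add: L)
  then have "is_solution (replicate (j - i) x)"
    using ij(1) by (simp add: is_solution_def)
  then show ?thesis
    unfolding monomial_minimal_solution_def monomial_minimal_size_def by (rule LeastI)
qed

end

theory Submission
  imports Defs
begin

text \<open>If the minimal solution \<open>(x, \<dots>, x)\<close> of size \<open>N\<close> were reducible, some \<open>(b, x, \<dots>, x, c)\<close> of size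
  \<open>3 \<le> l < N\<close> would be a solution. Let \<open>P = X\<^sup>l\<^sup>-\<^sup>2\<close> be the product of its \<open>l - 2\<close> middle factors, where
  \<open>X = M\<^sub>1(x)\<close>. The last entry of the product gives \<open>P\<^sub>1\<^sub>1 = \<plusminus>1\<close>, while \<open>P\<close> commutes with \<open>X\<close>
  and \<open>det P = 1\<close>. For \<open>r = P\<^sub>2\<^sub>1\<close> this forces \<open>r (r - P\<^sub>1\<^sub>1 x) = 0\<close>. In a field, either
  \<open>r = 0\<close> and \<open>P = \<plusminus>Id\<close>, or \<open>r = P\<^sub>1\<^sub>1 x\<close> and \<open>P = \<plusminus>X\<^sup>-\<^sup>2\<close>. So \<open>l - 2\<close> or \<open>l\<close>
  contradicts the minimality of \<open>N\<close>.\<close>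

lemmas matrix_2x2_simps = elem_matrix_def matrix_matrix_mult_def mat_def vec_eq_iff sum_2 forall_2

lemma det_M_matrix: "det (M_matrix as) = (1 :: 'a::comm_ring_1)"
  by (induction as) (simp_all add: det_mul, simp add: elem_matrix_def det_2)

lemma M_matrix_replicate_commute:
  "M_matrix (replicate n x) ** elem_matrix x = elem_matrix x ** M_matrix (replicate n x)"
proof -
  have "M_matrix (replicate (Suc n) x) = M_matrix (replicate n x @ [x])"
    by (simp add: replicate_append_same)
  then show ?thesis
    by (simp add: M_matrix_append)
qed

text \<open>Compare the entries (1,1) and (2,1) of \<open>P n ** elem_matrix x\<close> and
  \<open>elem_matrix x ** P n\<close>, so that the first column of \<open>P n\<close> determines the
  second.\<close>

lemma M_matrix_replicate_entries:
  fixes x :: "'a::comm_ring_1"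
  defines "P \<equiv> \<lambda>n. M_matrix (replicate n x)"
  shows "P n $ 1 $ 2 = - P n $ 2 $ 1" and "P n $ 2 $ 2 = P n $ 1 $ 1 - x * P n $ 2 $ 1"
proof -
  have eq: "P n ** elem_matrix x = elem_matrix x ** P n"
    unfolding P_def by (rule M_matrix_replicate_commute)
  show "P n $ 1 $ 2 = - P n $ 2 $ 1"
    using arg_cong[OF eq, of "\<lambda>M. M $ 1 $ 1"] by (simp add: matrix_2x2_simps algebra_simps eq_neg_iff_add_eq_0)
  show "P n $ 2 $ 2 = P n $ 1 $ 1 - x * P n $ 2 $ 1"
    using arg_cong[OF eq, of "\<lambda>M. M $ 2 $ 1"] by (simp add: matrix_2x2_simps algebra_simps)
qed

lemma monomial_solution_of_constant_middle:
  fixes x :: "'a::field"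
  assumes sol: "is_solution (b # replicate n x @ [c])" and "n > 0"
  shows "is_solution (replicate n x) \<or> is_solution (replicate (n + 2) x)"
proof -
  define P where "P = M_matrix (replicate n x)"
  define p r where "p = P $ 1 $ 1" and "r = P $ 2 $ 1"
  have entries: "P $ 1 $ 1 = p" "P $ 2 $ 1 = r" "P $ 1 $ 2 = - r" "P $ 2 $ 2 = p - x * r"
    using M_matrix_replicate_entries[of n x] by (simp_all add: P_def p_def r_def)
  have "M_matrix (b # replicate n x @ [c]) = elem_matrix c ** P ** elem_matrix b"
    by (simp add: M_matrix_append P_def)
  then have "elem_matrix c ** P ** elem_matrix b = mat 1 \<or>
      elem_matrix c ** P ** elem_matrix b = - mat 1"
    using sol by (simp add: is_solution_def)
  then have "(elem_matrix c ** P ** elem_matrix b) $ 2 $ 2 = 1 \<or>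
      (elem_matrix c ** P ** elem_matrix b) $ 2 $ 2 = - 1"
    by (auto simp: mat_def)
  \<comment> \<open>The second row of \<open>elem_matrix c\<close> is (1, 0) and the second column
    of \<open>elem_matrix b\<close> is (-1, 0), so \<open>b\<close> and \<open>c\<close> drop
    out.\<close>
  moreover have "(elem_matrix c ** P ** elem_matrix b) $ 2 $ 2 = - p"
    by (simp add: matrix_2x2_simps entries)
  ultimately have p: "p = 1 \<or> p = -1"
    by (auto simp: minus_equation_iff[of p])
  have "det P = 1"
    unfolding P_def by (rule det_M_matrix)
  then have "p * (p - x * r) + r * r = 1"
    by (simp add: det_2 entries)
  moreover have "p * p = 1"
    using p by auto
  ultimately have "r * (r - p * x) = 0"
    by (simp add: algebra_simps)
  then consider "r = 0" | "r = p * x"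
    by auto
  then show ?thesis
  proof cases
    case 1
    then have "P = mat 1 \<or> P = - mat 1"
      using p by (auto simp: matrix_2x2_simps entries)
    then show ?thesis
      using \<open>n > 0\<close> by (simp add: is_solution_def P_def)
  next
    case 2
    \<comment> \<open>Here the product is -p times the identity.\<close>
    then have "P ** elem_matrix x ** elem_matrix x = mat 1 \<or>
        P ** elem_matrix x ** elem_matrix x = - mat 1"
      using p by (auto simp: matrix_2x2_simps entries algebra_simps)
    then show ?thesis
      by (simp add: is_solution_def P_def)
  qed
qed

lemma tuple_equiv_replicateD:
  assumes "replicate n x \<sim>\<^sub>t bs"
  shows "bs = replicate n x"
proof -
  have "rotate k (replicate n x) = replicate n x" for k
    by (induction k) simp_all
  then show ?thesis
    using assms by (auto simp: tuple_equiv_def)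
qed

text \<open>The interior of \<open>bs\<close> enters the sum unchanged, while its end entries are
  only seen added to those of \<open>as\<close>. The sum has size
  \<open>length as + length bs - 2\<close>, which exceeds \<open>length bs\<close>.\<close>

lemma tuple_sum_eq_replicateE:
  fixes x :: "'a::comm_ring_1"
  assumes "as \<oplus>\<^sub>t bs = replicate n x" "length as \<ge> 3" "length bs \<ge> 3"
  obtains b c m where "bs = b # replicate m x @ [c]" "m > 0" "m + 2 < n"
proof -
  obtain b ds where "bs = b # ds"
    using assms(3) by (cases bs) auto
  moreover from this obtain ms c where "ds = ms @ [c]"
    using assms(3) by (cases ds rule: rev_cases) auto
  ultimately have bs: "bs = b # ms @ [c]"
    by simp
  then have "set ms \<subseteq> set (as \<oplus>\<^sub>t bs)"
    by (auto simp: tuple_sum_def)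
  then have "set ms \<subseteq> {x}"
    using assms(1) by auto
  then have "ms = replicate (length ms) x"
    by (auto intro!: replicate_eqI)
  then have "bs = b # replicate (length ms) x @ [c]"
    using bs by simp
  moreover have "length ms > 0" "length ms + 2 < n"
    using arg_cong[OF assms(1), of length] assms(2,3) by (auto simp: tuple_sum_def bs)
  ultimately show thesis
    by (rule that)
qed

lemma length_monomial_solution_ge_3:
  fixes x :: "'a::comm_ring_1"
  assumes "is_solution (replicate n x)" "x \<noteq> 0"
  shows "n \<ge> 3"
proof -
  \<comment> \<open>For size 1 the entry (2,2) is 0; for size 2 the off-diagonal entries are x and
    -x, hence nonzero.\<close>
  have "n \<noteq> 0" "n \<noteq> 1" "n \<noteq> 2"
    using assms by (auto simp: is_solution_def numeral_2_eq_2 matrix_2x2_simps)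
  then show ?thesis
    by linarith
qed

theorem theorem4p3:
  fixes x :: "'a::{field,finite}"
  assumes "x \<noteq> 0"
  shows "irreducible_solution (monomial_minimal_solution x)"
proof -
  define N where "N = monomial_minimal_size x"
  have solN: "is_solution (replicate N x)"
    using monomial_minimal_solution_is_solution[of x]
    by (simp add: monomial_minimal_solution_def N_def)
  have minimal: "\<not> is_solution (replicate n x)" if "n < N" for n
    using that not_less_Least unfolding N_def monomial_minimal_size_def by blast
  have "\<not> reducible_solution (replicate N x)"
  proof
    assume "reducible_solution (replicate N x)"
    then obtain as bs where bs: "is_solution bs" and lengths: "length as \<ge> 3" "length bs \<ge> 3"
      and "replicate N x \<sim>\<^sub>t as \<oplus>\<^sub>t bs"
      by (auto simp: reducible_solution_def)
    then have "as \<oplus>\<^sub>t bs = replicate N x"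
      by (simp add: tuple_equiv_replicateD)
    then obtain b c m where "bs = b # replicate m x @ [c]" "m > 0" "m + 2 < N"
      using lengths by (rule tuple_sum_eq_replicateE)
    then show False
      using monomial_solution_of_constant_middle[of b m x c] bs minimal[of m] minimal[of "m + 2"]
      by simp
  qed
  then show ?thesis
    using solN length_monomial_solution_ge_3[OF solN assms]
    by (simp add: irreducible_solution_def monomial_minimal_solution_def flip: N_def)
qed

end
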